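(* Let $\mathcal{P}$ be a convex two-dimensional pattern (without weights) and let $F$ be a figure of $\mathcal{P}$, with Laurent polynomial $\mathrm{Poly}_F(x,y)=\sum_{(a,b)\in F}x^ay^b$. Then $\mathrm{Poly}_F$ has a non-trivial strongly linear divisor if and only if $\mathcal{P}$ is not abelian rigid.
   Context: A figure is a finite subset of $\mathbb{Z}^2$; a pattern is the set of all integer translates of a fixed figure. A figure $F$ is convex if $F=\mathrm{conv}_{\mathbb{R}^2}(F)\cap\mathbb{Z}^2$; a pattern is convex if its figures are convex. For $v=(v_1,v_2)\in\mathbb{Z}^2$ and a natural number $n$, the strongly linear polynomial is $l(v,n)=\sum_{i=0}^n x^{iv_1}y^{iv_2}$; it is non-trivial if $v\neq0$ and $n\ge1$. Divisibility is in the ring of Laurent polynomials $\mathbb{Z}[x^{\pm1},y^{\pm1}]$ (so it does not depend on the choice of $F\in\mathcal{P}$). A two-dimensional word is a map $\mathbf{w}:\mathbb{Z}^2\to A$ with $A$ a finite alphabet; it is fully periodic if there are two linearly independent $p\in\mathbb{Z}^2$ with $\mathbf{w}(x+p)=\mathbf{w}(x)$ for all $x$. Two finite words are abelian equivalent if each letter occurs equally often in both. The abelian pattern complexity $a_{\mathbf{w}}(\mathcal{P})$ is the number of abelian equivalence classes of the restrictions of $\mathbf{w}$ to the figures $F'\in\mathcal{P}$ (i.e. the number of distinct vectors of letter counts $(|\{x\in F':\mathbf{w}(x)=a\}|)_{a\in A}$). $\mathcal{P}$ is abelian rigid if every two-dimensional word $\mathbf{w}$ (over any finite alphabet) with $a_{\mathbf{w}}(\mathcal{P})=1$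 is fully periodic. *)

theory Defs
  imports "HOL-Analysis.Analysis" "HOL-Library.Poly_Mapping"
begin

section \<open>Figures and patterns\<close>

type_synonym point = "int \<times> int"

definition embed :: "point \<Rightarrow> real \<times> real" where
  "embed p = (real_of_int (fst p), real_of_int (snd p))"

definition convex_figure :: "point set \<Rightarrow> bool" where
  "convex_figure F \<longleftrightarrow> finite F \<and> F = {p. embed p \<in> convex hull (embed ` F)}"

definition is_pattern :: "point set set \<Rightarrow> bool" where
  "is_pattern P \<longleftrightarrow> (\<exists>F. finite F \<and> P = range (\<lambda>t. (+) t ` F))"

definition convex_pattern :: "point set set \<Rightarrow> bool" where
  "convex_pattern P \<longleftrightarrow> is_pattern P \<and> (\<forall>F\<in>P. convex_figure F)"

section \<open>Laurent polynomials\<close>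

text \<open>The ring of integer Laurent polynomials in two variables is the group ring of the additive
  group of integer pairs: finitely supported coefficient functions with convolution as
  multiplication. The monomial with exponent vector \<open>p\<close> is \<open>Poly_Mapping.single p 1\<close>.\<close>

type_synonym laurent = "point \<Rightarrow>\<^sub>0 int"

definition figure_poly :: "point set \<Rightarrow> laurent" where
  "figure_poly F = (\<Sum>p\<in>F. Poly_Mapping.single p 1)"

definition strongly_linear :: "point \<Rightarrow> nat \<Rightarrow> laurent" where
  "strongly_linear v n = (\<Sum>i=0..n. Poly_Mapping.single (int i * fst v, int i * snd v) 1)"

section \<open>Words and abelian rigidity\<close>

definition fully_periodic :: "(point \<Rightarrow> 'a) \<Rightarrow> bool" where
  "fully_periodic w \<longleftrightarrow>
     (\<exists>p q. p \<noteq> q \<and> independent {embed p, embed q} \<and>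
            (\<forall>x. w (x + p) = w x) \<and> (\<forall>x. w (x + q) = w x))"

definition letter_counts :: "(point \<Rightarrow> 'a) \<Rightarrow> point set \<Rightarrow> 'a \<Rightarrow> nat" where
  "letter_counts w F = (\<lambda>a. card {x\<in>F. w x = a})"

text \<open>For a word over a finite alphabet only finitely many vectors of letter counts occur, so
  the cardinality below is a genuine one. Letters outside the alphabet have count 0.\<close>

definition abelian_complexity :: "(point \<Rightarrow> 'a) \<Rightarrow> point set set \<Rightarrow> nat" where
  "abelian_complexity w P = card (letter_counts w ` P)"

text \<open>A definition cannot quantify over types, so the alphabets are the finite sets of natural
  numbers. By the lemma \<open>abelian_rigid_any_alphabet\<close> this covers alphabets of every type.\<close>

definition abelian_rigid :: "point set set \<Rightarrow> bool" where
  "abelian_rigid P \<longleftrightarrow>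
     (\<forall>(A :: nat set) w. finite A \<longrightarrow> w \<in> UNIV \<rightarrow> A \<longrightarrow>
        abelian_complexity w P = 1 \<longrightarrow> fully_periodic w)"

lemma letter_counts_rename:
  assumes "inj_on f A" and "w \<in> UNIV \<rightarrow> A" and "letter_counts w F = letter_counts w G"
  shows "letter_counts (f \<circ> w) F = letter_counts (f \<circ> w) G"
proof
  fix b
  show "letter_counts (f \<circ> w) F b = letter_counts (f \<circ> w) G b"
  proof (cases "b \<in> f ` A")
    case True
    then obtain a where a: "a \<in> A" "b = f a" by blast
    have "f (w x) = b \<longleftrightarrow> w x = a" for x
      using assms(1,2) a by (auto dest: inj_onD)
    with assms(3) show ?thesis
      by (simp add: letter_counts_def fun_eq_iff)
  next
    case False
    then have "f (w x) \<noteq> b" for x using assms(2) by auto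
    then show ?thesis by (simp add: letter_counts_def)
  qed
qed

lemma abelian_rigid_any_alphabet:
  fixes A :: "'a set" and w :: "point \<Rightarrow> 'a"
  assumes "abelian_rigid P" and "finite A" and w: "w \<in> UNIV \<rightarrow> A"
    and c: "abelian_complexity w P = 1"
  shows "fully_periodic w"
proof -
  obtain f :: "'a \<Rightarrow> nat" where f: "inj_on f A"
    using finite_imp_inj_to_nat_seg[OF \<open>finite A\<close>] by blast
  obtain v where v: "letter_counts w ` P = {v}"
    using c by (auto simp: abelian_complexity_def card_1_singleton_iff)
  then obtain F where F: "F \<in> P" by blast
  have "letter_counts (f \<circ> w) G = letter_counts (f \<circ> w) F" if "G \<in> P" for G
  proof (rule letter_counts_rename[OF f w])
    have "letter_counts w G \<in> {v}" "letter_counts w F \<in> {v}"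
      using F that by (simp_all flip: v)
    then show "letter_counts w G = letter_counts w F" by simp
  qed
  with F have "letter_counts (f \<circ> w) ` P = {letter_counts (f \<circ> w) F}" by blast
  then have "abelian_complexity (f \<circ> w) P = 1"
    by (simp add: abelian_complexity_def)
  moreover have "f \<circ> w \<in> UNIV \<rightarrow> f ` A" using w by auto
  ultimately have "fully_periodic (f \<circ> w)"
    using assms(1,2) unfolding abelian_rigid_def by blast
  moreover have "f (w x) = f (w y) \<longleftrightarrow> w x = w y" for x y
    using f w by (auto dest: inj_onD)
  ultimately show ?thesis by (simp add: fully_periodic_def)
qed

end

theory Submission
  imports Defs
begin

text \<open>If \<open>l(v, n)\<close> divides the polynomial of \<open>F\<close>, every word in which each window
  \<open>x, x + v, \<dots>, x + nv\<close> contains exactly one letter 1 has constant counts on the translates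
  of \<open>F\<close>, and the phases on the lines in direction \<open>v\<close> are free.

  Conversely let \<open>w\<close> have constant sums over the translates of \<open>F\<close>. By the Frobenius
  congruence and boundedness of \<open>w\<close>, the sums over the translates of \<open>kF\<close> are constant for
  all \<open>k \<equiv> 1\<close> modulo some \<open>r\<close> (Kari and Szabados). Vandermonde elimination on these equations
  reduces the claim to two steps for complex-valued functions \<open>f\<close> of finite range with constant
  sums over \<open>F\<close>. If \<open>f\<close> is periodic in a direction \<open>v\<close>, it splits into eigenfunctions of a
  primitive translation \<open>u\<close>, with eigenvalue a root of unity \<open>\<zeta>\<close>. Such an eigenfunction satisfies
  a one-dimensional linear recurrence, non-trivial unless \<open>\<zeta> \<noteq> 1\<close> and its order \<open>d\<close> divides the length
  of every line segment of the convex set \<open>F\<close> in direction \<open>u\<close>, that is, unless \<open>l(u, d - 1)\<close>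
  divides the polynomial of \<open>F\<close>; so it is doubly periodic. If some difference
  \<open>f(x + a) - f(x + b)\<close> with \<open>a \<noteq> b\<close> is doubly periodic, then the differences of \<open>f\<close> along
  its periods are invariant under \<open>a - b\<close>, hence doubly periodic, so second differences of \<open>f\<close>
  vanish, and \<open>f\<close> has finite range, so \<open>f\<close> is doubly periodic.\<close>

section \<open>Laurent polynomials acting on integer words\<close>

definition scaled :: "int \<Rightarrow> point \<Rightarrow> point" where
  "scaled k p = (k * fst p, k * snd p)"

lemma scaled_simps [simp]: "scaled 0 p = 0" "scaled 1 p = p" "scaled k 0 = 0"
  by (simp_all add: scaled_def zero_prod_def)

lemma scaled_add_left: "scaled (k + l) p = scaled k p + scaled l p"
  by (simp add: scaled_def algebra_simps)

lemma scaled_scaled: "scaled k (scaled l p) = scaled (k * l) p"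
  by (simp add: scaled_def algebra_simps)

lemma scaled_eq_iff [simp]: "scaled k p = scaled k q \<longleftrightarrow> k = 0 \<or> p = q"
  by (auto simp: scaled_def prod_eq_iff)

text \<open>Monomials act as translations by \<open>+k\<close>, without the reflection of a
  convolution, so that the polynomial of \<open>F\<close> acts by summing over the translates of
  \<open>F\<close>.\<close>

definition act :: "laurent \<Rightarrow> (point \<Rightarrow> int) \<Rightarrow> point \<Rightarrow> int" where
  "act q f x = (\<Sum>k\<in>Poly_Mapping.keys q. Poly_Mapping.lookup q k * f (x + k))"

lemma act_superset:
  assumes "finite S" "Poly_Mapping.keys q \<subseteq> S"
  shows "act q f x = (\<Sum>k\<in>S. Poly_Mapping.lookup q k * f (x + k))"
  unfolding act_def using assms
  by (intro sum.mono_neutral_left) (auto simp: in_keys_iff)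

lemma act_0 [simp]: "act 0 f x = 0"
  by (simp add: act_def)

lemma act_single [simp]: "act (Poly_Mapping.single p 1) f x = f (x + p)"
  by (simp add: act_def)

lemma act_add: "act (q + r) f x = act q f x + act r f x"
proof -
  let ?S = "Poly_Mapping.keys q \<union> Poly_Mapping.keys r"
  have "act (q + r) f x = (\<Sum>k\<in>?S. Poly_Mapping.lookup (q + r) k * f (x + k))"
    using keys_add[of q r] by (intro act_superset) auto
  also have "\<dots> = act q f x + act r f x"
    by (simp add: act_superset[of ?S] lookup_add distrib_right sum.distrib)
  finally show ?thesis .
qed

lemma act_minus: "act (- q) f x = - act q f x"
  by (simp add: act_def sum_negf)

lemma act_diff: "act (q - r) f x = act q f x - act r f x"
  using act_add[of q "- r"] by (simp add: act_minus)

lemma act_sum: "act (\<Sum>i\<in>I. q i) f x = (\<Sum>i\<in>I. act (q i) f x)"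
  by (induction I rule: infinite_finite_induct) (simp_all add: act_add)

text \<open>Both sides are additive in \<open>q\<close> and in \<open>r\<close>, which reduces the
  identity to monomials; \<open>frag_induction\<close> treats Laurent polynomials as a free abelian
  group.\<close>

lemma act_mult: "act (q * r) f x = act q (act r f) x"
proof (induction q arbitrary: x rule: frag_induction[OF order_refl])
  case 1
  then show ?case by simp
next
  case (2 p)
  show ?case
  proof (induction r rule: frag_induction[OF order_refl])
    case 1
    then show ?case by simp
  next
    case (2 s)
    then show ?case by (simp add: mult_single add.assoc)
  next
    case (3 a b)
    then show ?case by (simp add: right_diff_distrib act_diff)
  qed
next
  case (3 a b)
  then show ?case by (simp add: left_diff_distrib act_diff)
qed

lemma act_const: "act q (\<lambda>_. c) x = act q (\<lambda>_. 1) 0 * c"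
  by (simp add: act_def sum_distrib_right)

lemma act_figure_poly: "act (figure_poly F) f x = (\<Sum>p\<in>F. f (x + p))"
  by (simp add: figure_poly_def act_sum)

lemma act_strongly_linear: "act (strongly_linear v n) f x = (\<Sum>i=0..n. f (x + scaled (int i) v))"
  by (simp add: strongly_linear_def act_sum scaled_def)

lemma single_power: "Poly_Mapping.single p (1 :: int) ^ n = Poly_Mapping.single (scaled (int n) p) 1"
proof (induction n)
  case 0
  then show ?case by simp
next
  case (Suc n)
  then show ?case
    by (simp add: mult_single scaled_add_left add.commute)
qed

section \<open>The Frobenius congruence and sums over dilated figures\<close>

lemma prime_dvd_frobenius_add:
  fixes x y :: "'a :: comm_ring_1"
  assumes "prime p"
  shows "of_nat p dvd (x + y) ^ p - (x ^ p + y ^ p)"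
proof -
  have p: "p > 0" using assms prime_gt_0_nat by blast
  have "{..p} = insert 0 (insert p {0<..<p})" using p by auto
  then have "(x + y) ^ p = x ^ p + y ^ p + (\<Sum>k\<in>{0<..<p}. of_nat (p choose k) * x ^ k * y ^ (p - k))"
    using p by (simp add: binomial_ring)
  moreover have "of_nat p dvd (\<Sum>k\<in>{0<..<p}. of_nat (p choose k) * x ^ k * y ^ (p - k))"
  proof (intro dvd_sum dvd_mult2)
    fix k assume "k \<in> {0<..<p}"
    then have "p dvd p choose k" using assms by (intro dvd_choose_prime) auto
    then show "of_nat p dvd (of_nat (p choose k) :: 'a)"
      by (metis dvdE dvd_triv_left of_nat_mult)
  qed
  ultimately show ?thesis by simp
qed

lemma prime_dvd_frobenius_sum:
  fixes f :: "'b \<Rightarrow> 'a :: comm_ring_1"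
  assumes "prime p" "finite I"
  shows "of_nat p dvd (\<Sum>i\<in>I. f i) ^ p - (\<Sum>i\<in>I. f i ^ p)"
  using assms(2)
proof (induction I rule: finite_induct)
  case empty
  then show ?case using prime_gt_0_nat[OF assms(1)] by (simp add: power_0_left)
next
  case (insert i I)
  have "of_nat p dvd ((f i + sum f I) ^ p - (f i ^ p + sum f I ^ p)) + (sum f I ^ p - (\<Sum>i\<in>I. f i ^ p))"
    using insert.IH prime_dvd_frobenius_add[OF assms(1)] by (rule dvd_add[rotated])
  also have "\<dots> = (f i + sum f I) ^ p - (f i ^ p + (\<Sum>i\<in>I. f i ^ p))"
    by simp
  finally show ?case using insert by simp
qed

text \<open>One factor turns \<open>f\<close> into a constant and the others preserve constants;
  \<open>n > 0\<close> provides that factor.\<close>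

lemma act_power_const:
  assumes "\<And>x. act q f x = c" "n > 0"
  shows "act (q ^ n) f x = act (q ^ n) f y"
  using assms(2)
proof (induction n arbitrary: x y rule: nat_induct_non_zero)
  case 1
  then show ?case using assms(1) by simp
next
  case (Suc n)
  have "act (q ^ Suc n) f x = act (q ^ n) (\<lambda>_. c) x" for x
    using ext[of "act q f", OF assms(1)] by (simp only: power_Suc2 act_mult)
  then show ?case using act_const[of "q ^ n" c] by simp
qed

lemma act_of_nat_mult: "act (of_nat n * q) f x = int n * act q f x"
  by (induction n) (simp_all add: distrib_right act_add)

text \<open>Modulo \<open>m\<close>, the \<open>m\<close>-th power of the figure polynomial is the
  polynomial of the figure dilated by \<open>m\<close>, so the dilated sums agree modulo
  \<open>m\<close>. They lie between 0 and \<open>card F * B < m\<close>, hence are equal.\<close>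

lemma sum_scaled_prime_const:
  fixes f :: "point \<Rightarrow> int"
  assumes F: "finite F" and c: "\<And>x. (\<Sum>p\<in>F. f (x + p)) = c"
    and f: "\<And>x. 0 \<le> f x" "\<And>x. f x \<le> B"
    and m: "prime m" "int m > int (card F) * B"
  shows "(\<Sum>p\<in>F. f (x + scaled (int m) p)) = (\<Sum>p\<in>F. f (y + scaled (int m) p))"
proof -
  let ?s = "\<lambda>x. \<Sum>p\<in>F. f (x + scaled (int m) p)"
  obtain q where q: "figure_poly F ^ m - (\<Sum>p\<in>F. Poly_Mapping.single (scaled (int m) p) 1) = of_nat m * q"
    using prime_dvd_frobenius_sum[OF m(1) F, of "\<lambda>p. Poly_Mapping.single p (1 :: int)"]
    unfolding single_power figure_poly_def dvd_def by blast
  have eq: "act (figure_poly F ^ m) f x - ?s x = int m * act q f x" for x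
    using arg_cong[OF q, of "\<lambda>q. act q f x"]
    by (simp add: act_diff act_sum act_of_nat_mult)
  have "act (figure_poly F ^ m) f x = act (figure_poly F ^ m) f y"
    using c prime_gt_0_nat[OF m(1)] by (intro act_power_const) (auto simp: act_figure_poly)
  then have "?s x - ?s y = int m * (act q f y - act q f x)"
    using eq[of x] eq[of y] by (simp add: algebra_simps)
  moreover have "0 \<le> ?s x \<and> ?s x \<le> int (card F) * B" for x
    using f sum_bounded_above[of F "\<lambda>p. f (x + scaled (int m) p)" B]
    by (simp add: sum_nonneg del: split_paired_All)
  from this[of x] this[of y] have "\<bar>?s x - ?s y\<bar> < int m"
    using m(2) by linarith
  ultimately show ?thesis
    by (metis dvd_triv_left dvd_imp_le_int eq_iff_diff_eq_0 abs_of_nat leD)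
qed

text \<open>Restricting to \<open>k \<equiv> 1\<close> modulo the factorial keeps all prime factors of \<open>k\<close> large.\<close>

lemma sum_scaled_const:
  fixes f :: "point \<Rightarrow> int"
  assumes F: "finite F" and c: "\<And>x. (\<Sum>p\<in>F. f (x + p)) = c"
    and f: "\<And>x. 0 \<le> f x" "\<And>x. f x \<le> B"
  shows "\<exists>r>0. \<forall>i x y. (\<Sum>p\<in>F. f (x + scaled (1 + int i * r) p))
      = (\<Sum>p\<in>F. f (y + scaled (1 + int i * r) p))"
proof -
  define b where "b = nat (int (card F) * B)"
  \<comment> \<open>Induction over the prime factors of \<open>k\<close>: the prime case is applied
    to the figure dilated so far, which has the cardinality of \<open>F\<close>, so the threshold
    \<open>b\<close> serves at every stage.\<close>
  have *: "(\<forall>q. prime q \<longrightarrow> q dvd k \<longrightarrow> q > b) \<longrightarrow>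
    (\<forall>x y. (\<Sum>p\<in>F. f (x + scaled (int k) p))
        = (\<Sum>p\<in>F. f (y + scaled (int k) p)))" if "k > 0" for k
    using that
  proof (induction k rule: prime_divisors_induct)
    case zero
    then show ?case by simp
  next
    case (unit x)
    then show ?case using c by simp
  next
    case (factor m k)
    show ?case
    proof (intro impI allI)
      fix x y
      assume big: "\<forall>q. prime q \<longrightarrow> q dvd m * k \<longrightarrow> q > b"
      have k: "k > 0" using factor.prems by auto
      have IH: "\<forall>x y. (\<Sum>p\<in>F. f (x + scaled (int k) p)) = (\<Sum>p\<in>F. f (y + scaled (int k) p))"
        using factor.IH k big by auto
      have inj: "inj_on (scaled (int k)) F" using k by (auto simp: inj_on_def)
      have "m > b" using big factor.hyps by auto
      then have m: "int m > int (card (scaled (int k) ` F)) * B"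
        by (simp add: card_image[OF inj] b_def)
      have "(\<Sum>p\<in>scaled (int k) ` F. f (x + scaled (int m) p))
          = (\<Sum>p\<in>scaled (int k) ` F. f (y + scaled (int m) p))"
      proof (rule sum_scaled_prime_const)
        show "(\<Sum>p\<in>scaled (int k) ` F. f (z + p)) = (\<Sum>p\<in>F. f (0 + scaled (int k) p))" for z
          using IH[rule_format, of z 0] by (simp add: sum.reindex[OF inj])
      qed (use F f m factor.hyps in auto)
      then show "(\<Sum>p\<in>F. f (x + scaled (int (m * k)) p)) = (\<Sum>p\<in>F. f (y + scaled (int (m * k)) p))"
        by (simp add: sum.reindex[OF inj] scaled_scaled)
    qed
  qed
  have "q > b" if "prime q" "q dvd 1 + i * fact b" for q i :: nat
  proof (rule ccontr)
    assume "\<not> q > b"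
    then have "q dvd fact b" using that(1) by (intro dvd_fact) (auto simp: Suc_leI prime_gt_0_nat)
    then have "q dvd 1" using that(2) by (metis dvd_add_left_iff dvd_mult)
    then show False using that(1) by auto
  qed
  then have "\<forall>x y. (\<Sum>p\<in>F. f (x + scaled (1 + int i * fact b) p))
      = (\<Sum>p\<in>F. f (y + scaled (1 + int i * fact b) p))" for i
    using *[of "1 + i * fact b"] by simp
  then show ?thesis by (intro exI[of _ "fact b"]) auto
qed

section \<open>Linear recurrences over finite alphabets\<close>

text \<open>The coefficient at \<open>Max J\<close> is non-zero, so each value is determined by the
  \<open>Max J - Min J\<close> values before it, and a window of zeros propagates to the
  right.\<close>

lemma recurrence_zero_forward:
  fixes D :: "int \<Rightarrow> complex"
  assumes J: "finite J" "J \<noteq> {}" and l: "\<And>j. j \<in> J \<Longrightarrow> l j \<noteq> 0"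
    and rec: "\<And>n. (\<Sum>j\<in>J. l j * D (n + j)) = 0"
    and window: "\<And>n. m \<le> n \<Longrightarrow> n < m + (Max J - Min J) \<Longrightarrow> D n = 0"
  shows "m \<le> n \<Longrightarrow> D n = 0"
proof (induction "nat (n - m)" arbitrary: n rule: less_induct)
  case less
  show ?case
  proof (cases "n < m + (Max J - Min J)")
    case True
    then show ?thesis using window less.prems by blast
  next
    case False
    have "D (n - Max J + j) = 0" if "j \<in> J - {Max J}" for j
    proof -
      have "Min J \<le> j" "j < Max J"
        using that J Max_ge[of J j] by (auto simp: less_le)
      then show ?thesis using False by (intro less.hyps) auto
    qed
    then have "(\<Sum>j\<in>J. l j * D (n - Max J + j)) = l (Max J) * D n"
      using J by (subst sum.remove[of J "Max J"]) auto
    then show ?thesis using rec l J by (metis Max_in mult_eq_0_iff)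
  qed
qed

lemma recurrence_zero:
  fixes D :: "int \<Rightarrow> complex"
  assumes J: "finite J" "J \<noteq> {}" and l: "\<And>j. j \<in> J \<Longrightarrow> l j \<noteq> 0"
    and rec: "\<And>n. (\<Sum>j\<in>J. l j * D (n + j)) = 0"
    and window: "\<And>n. m \<le> n \<Longrightarrow> n < m + (Max J - Min J) \<Longrightarrow> D n = 0"
  shows "D n = 0"
proof (cases "m \<le> n")
  case True
  then show ?thesis using recurrence_zero_forward[OF J l rec window] by blast
next
  case False
  have inj: "inj_on uminus J" by simp
  have mm: "Max (uminus ` J) = - Min J" "Min (uminus ` J) = - Max J"
    using J by (auto intro!: Max_eqI Min_eqI)
  \<comment> \<open>The left end of the window after the reflection \<open>n\<close> to
    \<open>- n\<close>, which turns backward propagation into forward propagation.\<close>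
  let ?m = "1 - m - (Max J - Min J)"
  have "D (- (- n)) = 0"
  proof (rule recurrence_zero_forward[where J = "uminus ` J" and l = "\<lambda>j. l (- j)" and m = ?m
        and D = "\<lambda>n. D (- n)" and n = "- n"])
    show "(\<Sum>j\<in>uminus ` J. l (- j) * D (- (n + j))) = 0" for n
      using rec[of "- n"] by (simp add: sum.reindex[OF inj])
    show "D (- n) = 0" if "?m \<le> n" "n < ?m + (Max (uminus ` J) - Min (uminus ` J))" for n
      using that unfolding mm by (intro window) auto
    have "Min J \<le> Max J" using J by (simp add: Min_le_iff)
    then show "?m \<le> - n" using False by auto
  qed (use J l in auto)
  then show ?thesis by simp
qed

text \<open>By the pigeonhole principle two windows of length \<open>Max J - Min J\<close> coincide.
  The difference of \<open>s\<close> and its shift by their distance satisfies the homogeneous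
  recurrence and vanishes on a window, hence everywhere.\<close>

lemma recurrence_periodic:
  fixes s :: "int \<Rightarrow> complex"
  assumes J: "finite J" "J \<noteq> {}" and l: "\<And>j. j \<in> J \<Longrightarrow> l j \<noteq> 0"
    and rec: "\<And>n. (\<Sum>j\<in>J. l j * s (n + j)) = c" and fin: "finite (range s)"
  shows "\<exists>M>0. \<forall>n. s (n + M) = s n"
proof -
  define L where "L = nat (Max J - Min J)"
  define W where "W n = map (\<lambda>k. s (int n + int k)) [0..<L]" for n
  have "range W \<subseteq> {xs. set xs \<subseteq> range s \<and> length xs = L}"
    by (auto simp: W_def)
  then have "finite (range W)"
    using finite_lists_length_eq[OF fin] finite_subset by blast
  then have "\<not> inj W" using finite_imageD infinite_UNIV_nat by blast
  then obtain a b where ab: "a < b" "W a = W b"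
    by (metis injI linorder_neqE_nat)
  define M where "M = int b - int a"
  have "s (n + M) - s n = 0" for n
  proof (rule recurrence_zero[OF J l, where D = "\<lambda>n. s (n + M) - s n" and m = "int a"])
    show "(\<Sum>j\<in>J. l j * (s (n + j + M) - s (n + j))) = 0" for n
      using rec[of "n + M"] rec[of n] by (simp add: right_diff_distrib sum_subtractf algebra_simps)
    fix n assume n: "int a \<le> n" "n < int a + (Max J - Min J)"
    then have "nat (n - int a) < L" by (auto simp: L_def)
    then have "W a ! nat (n - int a) = s n" "W b ! nat (n - int a) = s (n + M)"
      using n(1) by (simp_all add: W_def M_def algebra_simps)
    then show "s (n + M) - s n = 0" using ab(2) by simp
  qed
  then show ?thesis using ab(1) by (intro exI[of _ M]) (auto simp: M_def)
qed

section \<open>Doubly periodic and balanced functions\<close>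

text \<open>One \<open>M\<close> serves all directions, so two such functions share the period given
  by the product of their constants.\<close>

definition doubly_periodic :: "(point \<Rightarrow> 'a) \<Rightarrow> bool" where
  "doubly_periodic f \<longleftrightarrow> (\<exists>M>0. \<forall>x a. f (x + scaled M a) = f x)"

text \<open>Complex values keep the class closed under the linear combinations with roots of unity
  used below; the finite range is what pigeonhole arguments need.\<close>

definition balanced :: "point set \<Rightarrow> (point \<Rightarrow> complex) \<Rightarrow> bool" where
  "balanced F f \<longleftrightarrow> finite (range f) \<and> (\<exists>c. \<forall>x. (\<Sum>p\<in>F. f (x + p)) = c)"

lemma doubly_periodic_const: "doubly_periodic (\<lambda>_. c)"
  unfolding doubly_periodic_def by (intro exI[of _ 1]) simp

lemma doubly_periodic_shift: "doubly_periodic f \<Longrightarrow> doubly_periodic (\<lambda>x. f (x + a))"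
  unfolding doubly_periodic_def by (metis add.commute add.left_commute)

lemma doubly_periodic_map2:
  assumes "doubly_periodic f" "doubly_periodic g"
  shows "doubly_periodic (\<lambda>x. h (f x) (g x))"
proof -
  obtain M where M: "M > 0" "\<And>x a. f (x + scaled M a) = f x"
      using assms(1) unfolding doubly_periodic_def by blast
  obtain N where N: "N > 0" "\<And>x a. g (x + scaled N a) = g x"
      using assms(2) unfolding doubly_periodic_def by blast
  have "f (x + scaled (M * N) a) = f x" "g (x + scaled (M * N) a) = g x" for x a
    using M(2)[of x "scaled N a"] N(2)[of x "scaled M a"] by (simp_all add: scaled_scaled mult.commute)
  then show ?thesis unfolding doubly_periodic_def using M(1) N(1) by (intro exI[of _ "M * N"]) simp
qed

lemma doubly_periodic_sum:
  fixes f :: "'i \<Rightarrow> point \<Rightarrow> 'a :: comm_monoid_add"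
  assumes "\<And>i. i \<in> I \<Longrightarrow> doubly_periodic (f i)"
  shows "doubly_periodic (\<lambda>x. \<Sum>i\<in>I. f i x)"
  using assms
  by (induction I rule: infinite_finite_induct) (simp_all add: doubly_periodic_const doubly_periodic_map2[where h = "(+)"])

lemma doubly_periodic_map: "doubly_periodic f \<Longrightarrow> doubly_periodic (\<lambda>x. h (f x))"
  using doubly_periodic_map2[of f f "\<lambda>a _. h a"] by simp

lemma balanced_const_zero: "balanced F (\<lambda>_. 0)"
  by (simp add: balanced_def)

lemma balanced_shift:
  assumes "balanced F f" shows "balanced F (\<lambda>x. f (x + a))"
proof -
  have "range (\<lambda>x. f (x + a)) \<subseteq> range f" by blast
  moreover have "(\<Sum>p\<in>F. f (x + p + a)) = (\<Sum>p\<in>F. f (x + a + p))" for x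
    by (simp add: add.assoc add.commute[of _ a])
  ultimately show ?thesis using assms unfolding balanced_def by (metis finite_subset)
qed

lemma balanced_add:
  assumes "balanced F f" "balanced F g" shows "balanced F (\<lambda>x. f x + g x)"
proof -
  have "range (\<lambda>x. f x + g x) \<subseteq> (\<lambda>(a, b). a + b) ` (range f \<times> range g)" by auto
  then have "finite (range (\<lambda>x. f x + g x))"
    using assms unfolding balanced_def by (meson finite_SigmaI finite_imageI finite_subset)
  then show ?thesis using assms unfolding balanced_def by (auto simp: sum.distrib)
qed

lemma balanced_cmult:
  assumes "balanced F f" shows "balanced F (\<lambda>x. k * f x)"
proof -
  have "range (\<lambda>x. k * f x) = (*) k ` range f" by auto
  then show ?thesis using assms unfolding balanced_def by (auto simp flip: sum_distrib_left)
qed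

lemma balanced_diff:
  assumes "balanced F f" "balanced F g" shows "balanced F (\<lambda>x. f x - g x)"
  using balanced_add[OF assms(1) balanced_cmult[OF assms(2), of "-1"]] by simp

lemma balanced_sum:
  assumes "\<And>i. i \<in> I \<Longrightarrow> balanced F (f i)"
  shows "balanced F (\<lambda>x. \<Sum>i\<in>I. f i x)"
  using assms
  by (induction I rule: infinite_finite_induct) (simp_all add: balanced_const_zero balanced_add)

section \<open>Eigenfunctions of a primitive translation\<close>

text \<open>The Bezout identity says that \<open>u\<close> and \<open>(-t, s)\<close> form a lattice
  basis of determinant 1; \<open>pt i j\<close> is the point with coordinates \<open>i\<close>,
  \<open>j\<close> in it.\<close>

locale primitive_frame =
  fixes u :: point and s t :: int
  assumes bezout: "s * fst u + t * snd u = 1"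
begin

definition pt :: "int \<Rightarrow> int \<Rightarrow> point" where
  "pt i j = (i * fst u - j * t, i * snd u + j * s)"

text \<open>The value at \<zeta> of the one-variable polynomial of the \<open>j\<close>-th line of
  \<open>F\<close> in direction \<open>u\<close>.\<close>

definition line_sum :: "point set \<Rightarrow> complex \<Rightarrow> int \<Rightarrow> complex" where
  "line_sum F \<zeta> j = (\<Sum>i | pt i j \<in> F. \<zeta> powi i)"

lemma pt_add: "pt i j + pt i' j' = pt (i + i') (j + j')"
  by (simp add: pt_def algebra_simps)

lemma pt_10: "pt 1 0 = u"
  by (simp add: pt_def)

lemma pt_add_u: "x + pt i j + u = x + pt (i + 1) j"
  using pt_add[of i j 1 0] by (simp add: pt_10 add.assoc)

lemma scaled_pt: "scaled k (pt i j) = pt (k * i) (k * j)"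
  by (simp add: pt_def scaled_def algebra_simps)

lemma pt_coords: "pt (s * fst p + t * snd p) (fst u * snd p - snd u * fst p) = p"
proof -
  have "fst (pt (s * fst p + t * snd p) (fst u * snd p - snd u * fst p)) = (s * fst u + t * snd u) * fst p"
    by (simp add: pt_def algebra_simps)
  moreover have "snd (pt (s * fst p + t * snd p) (fst u * snd p - snd u * fst p)) = (s * fst u + t * snd u) * snd p"
    by (simp add: pt_def algebra_simps)
  ultimately show ?thesis using bezout by (simp add: prod_eq_iff)
qed

lemma coords_pt:
  "s * fst (pt i j) + t * snd (pt i j) = i" "fst u * snd (pt i j) - snd u * fst (pt i j) = j"
proof -
  have "s * fst (pt i j) + t * snd (pt i j) = i * (s * fst u + t * snd u)"
       "fst u * snd (pt i j) - snd u * fst (pt i j) = j * (s * fst u + t * snd u)"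
    by (simp_all add: pt_def algebra_simps)
  then show "s * fst (pt i j) + t * snd (pt i j) = i" "fst u * snd (pt i j) - snd u * fst (pt i j) = j"
    unfolding bezout by simp_all
qed

lemma pt_eq_iff [simp]: "pt i j = pt i' j' \<longleftrightarrow> i = i' \<and> j = j'"
by (metis coords_pt)

lemma pt_cases: obtains i j where "p = pt i j"
  using pt_coords[of p] by metis

lemma finite_lines:
  assumes "finite F"
  shows "finite {i. pt i j \<in> F}" "finite {j. \<exists>i. pt i j \<in> F}"
proof -
  have "{i. pt i j \<in> F} \<subseteq> (\<lambda>p. THE i. \<exists>j. p = pt i j) ` F"
    by (auto intro!: rev_image_eqI)
  then show "finite {i. pt i j \<in> F}" using assms finite_surj by blast
  have "{j. \<exists>i. pt i j \<in> F} \<subseteq> (\<lambda>p. THE j. \<exists>i. p = pt i j) ` F"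
    by (auto intro!: rev_image_eqI)
  then show "finite {j. \<exists>i. pt i j \<in> F}" using assms finite_surj by blast
qed

lemma sum_by_lines:
  assumes "finite F"
  shows "(\<Sum>p\<in>F. g p) = (\<Sum>j | \<exists>i. pt i j \<in> F. \<Sum>i | pt i j \<in> F. g (pt i j))"
proof -
  have ex: "\<exists>i. pt i (fst u * snd p - snd u * fst p) \<in> F" if "p \<in> F" for p
    using pt_coords[of p] that by metis
  have "(\<Sum>p\<in>F. g p) = (\<Sum>(j, i)\<in>(SIGMA j:{j. \<exists>i. pt i j \<in> F}. {i. pt i j \<in> F}). g (pt i j))"
    by (rule sum.reindex_bij_witness[where j = "\<lambda>p. (fst u * snd p - snd u * fst p, s * fst p + t * snd p)"
          and i = "\<lambda>(j, i). pt i j"])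
       (use ex in \<open>auto simp: pt_coords coords_pt\<close>)
  then show ?thesis using finite_lines[OF assms] by (simp add: sum.Sigma)
qed

lemma eigen_powi:
  fixes f :: "point \<Rightarrow> complex"
  assumes eig: "\<And>x. f (x + u) = \<zeta> * f x" and z: "\<zeta> \<noteq> 0"
  shows "f (x + pt i j) = \<zeta> powi i * f (x + pt 0 j)"
proof (induction i rule: int_induct[where k = 0])
  case base
  then show ?case by simp
next
  case (step1 i)
  have "f (x + pt (i + 1) j) = f (x + pt i j + u)"
    by (simp add: pt_add_u)
  then show ?case using eig step1 z by (simp add: power_int_add)
next
  case (step2 i)
  have "f (x + pt i j) = f (x + pt (i - 1) j + u)"
    by (simp add: pt_add_u)
  then have "\<zeta> * f (x + pt (i - 1) j) = \<zeta> powi i * f (x + pt 0 j)" using eig step2 by simp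
  then show ?case using z by (simp add: power_int_diff field_simps)
qed

text \<open>Summed line by line, the balance condition is a recurrence for \<open>f (pt 0 n)\<close>
  with the line sums as coefficients. It yields a period \<open>M\<close> across the lines, while
  the root of unity \<zeta> gives the period \<open>m\<close> along them.\<close>

lemma eigenfunction_doubly_periodic:
  assumes F: "finite F" and bal: "balanced F f"
    and eig: "\<And>x. f (x + u) = \<zeta> * f x" and z: "\<zeta> ^ m = 1" "m > 0"
    and line: "line_sum F \<zeta> j0 \<noteq> 0"
  shows "doubly_periodic f"
proof -
  have z0: "\<zeta> \<noteq> 0" using z by (metis power_0_left zero_neq_one not_gr0)
  obtain c where c: "\<And>x. (\<Sum>p\<in>F. f (x + p)) = c" using bal unfolding balanced_def by blast
  \<comment> \<open>Only lines with non-zero sum are kept, as the recurrence lemma requires non-zero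
    coefficients.\<close>
  define J where "J = {j. line_sum F \<zeta> j \<noteq> 0}"
  have sub: "J \<subseteq> {j. \<exists>i. pt i j \<in> F}"
    by (auto simp: J_def line_sum_def) (metis (no_types, lifting) Collect_empty_eq sum.empty)
  have "\<exists>M>0. \<forall>n. f (pt 0 (n + M)) = f (pt 0 n)"
  proof (rule recurrence_periodic[where J = J and l = "line_sum F \<zeta>" and c = c])
    show "finite J" using sub finite_lines[OF F] finite_subset by blast
    show "J \<noteq> {}" using line by (auto simp: J_def)
    show "(\<Sum>j\<in>J. line_sum F \<zeta> j * f (pt 0 (n + j))) = c" for n
    proof -
      have "c = (\<Sum>p\<in>F. f (pt 0 n + p))" using c by simp
      also have "\<dots> = (\<Sum>j | \<exists>i. pt i j \<in> F. line_sum F \<zeta> j * f (pt 0 (n + j)))"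
        unfolding sum_by_lines[OF F] line_sum_def
        by (subst eigen_powi[where f = f, OF eig z0]) (simp add: pt_add sum_distrib_right)
      also have "\<dots> = (\<Sum>j\<in>J. line_sum F \<zeta> j * f (pt 0 (n + j)))"
        using sub finite_lines[OF F] by (intro sum.mono_neutral_right) (auto simp: J_def)
      finally show ?thesis by simp
    qed
    have "range (\<lambda>n. f (pt 0 n)) \<subseteq> range f" by auto
    then show "finite (range (\<lambda>n. f (pt 0 n)))"
      using bal finite_subset unfolding balanced_def by blast
  qed (auto simp: J_def)
  then obtain M where M: "M > 0" "\<And>n. f (pt 0 (n + M)) = f (pt 0 n)" by blast
  have Mk: "f (pt 0 (n + k * M)) = f (pt 0 n)" for n k
  proof (induction k rule: int_induct[where k = 0])
    case base
    then show ?case by simp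
  next
    case (step1 k)
    then show ?case using M(2)[of "n + k * M"] by (simp add: algebra_simps)
  next
    case (step2 k)
    then show ?case using M(2)[of "n + (k - 1) * M"] by (simp add: algebra_simps)
  qed
  have zk: "\<zeta> powi (k * int m) = 1" for k
    using z(1) by (metis mult.commute power_int_1_left power_int_mult power_int_of_nat)
  have "f (x + scaled (M * int m) a) = f x" for x a
  proof -
    obtain i j where x: "x = pt i j" using pt_cases .
    obtain i' j' where a: "a = pt i' j'" using pt_cases .
    have e: "f (pt i j) = \<zeta> powi i * f (pt 0 j)" for i j
      by (rule eigen_powi[where f = f and x = 0, OF eig z0, unfolded add_0])
    have "f (x + scaled (M * int m) a) = f (pt (i + (M * i') * int m) (j + (int m * j') * M))"
      by (simp add: x a scaled_pt pt_add algebra_simps)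
    also have "\<dots> = \<zeta> powi i * f (pt 0 j)"
      by (subst e, subst Mk) (use z0 in \<open>simp add: power_int_add zk\<close>)
    also have "\<dots> = f x"
      unfolding x by (rule e[symmetric])
    finally show ?thesis .
  qed
  then show ?thesis unfolding doubly_periodic_def using M(1) z(2) by (intro exI[of _ "M * int m"]) simp
qed

end

section \<open>Lines of a convex figure and strongly linear divisors\<close>

lemma int_interval:
  fixes I :: "int set"
  assumes "finite I" and conv: "\<And>a b c. a \<in> I \<Longrightarrow> c \<in> I \<Longrightarrow> a \<le> b \<Longrightarrow> b \<le> c \<Longrightarrow> b \<in> I"
  shows "\<exists>l k. I = {l..<l + int k}"
proof (cases "I = {}")
  case True
  then show ?thesis by (intro exI[of _ 0]) auto
next
  case False
  have mem: "Min I \<in> I" "Max I \<in> I" using assms(1) False by simp_all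
  then have "Min I \<le> Max I" using assms(1) by simp
  have "I = {Min I..Max I}"
  proof
    show "I \<subseteq> {Min I..Max I}" using assms(1) by auto
    show "{Min I..Max I} \<subseteq> I" using conv[OF mem] by auto
  qed
  also have "\<dots> = {Min I..<Min I + int (nat (Max I + 1 - Min I))}"
    using \<open>Min I \<le> Max I\<close> by auto
  finally show ?thesis by blast
qed

lemma embed_convex_combination:
  assumes F: "convex_figure F" and "p \<in> F" "q \<in> F" "0 \<le> \<theta>" "\<theta> \<le> 1"
    and r: "embed r = (1 - \<theta>) *\<^sub>R embed p + \<theta> *\<^sub>R embed q"
  shows "r \<in> F"
proof -
  have "embed p \<in> convex hull (embed ` F)" "embed q \<in> convex hull (embed ` F)"
    using assms(2,3) by (auto intro: hull_inc)
  then have "embed r \<in> convex hull (embed ` F)"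
    unfolding r using assms(4,5) by (intro convexD_alt convex_convex_hull)
  then show ?thesis using F unfolding convex_figure_def by blast
qed

lemma sum_lessThan_Suc_cyclic:
  fixes g :: "nat \<Rightarrow> 'a :: ab_group_add"
  assumes "g m = g 0"
  shows "(\<Sum>i<m. g (Suc i)) = (\<Sum>i<m. g i)"
  using sum.lessThan_Suc_shift[of g m] assms by simp

context primitive_frame
begin

lemma line_interval:
  assumes F: "convex_figure F"
  shows "\<exists>l k. {i. pt i j \<in> F} = {l..<l + int k}"
proof (rule int_interval)
  show "finite {i. pt i j \<in> F}" using F finite_lines unfolding convex_figure_def by blast
  fix a b c assume ac: "a \<in> {i. pt i j \<in> F}" "c \<in> {i. pt i j \<in> F}" and abc: "a \<le> b" "b \<le> c"
  show "b \<in> {i. pt i j \<in> F}"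
  proof (cases "a = c")
    case True
    then show ?thesis using ac abc by auto
  next
    case False
    define \<theta> where "\<theta> = real_of_int (b - a) / real_of_int (c - a)"
    have th: "0 \<le> \<theta>" "\<theta> \<le> 1" using False abc by (auto simp: \<theta>_def divide_simps)
    have "\<theta> * real_of_int (c - a) = real_of_int (b - a)" using False by (simp add: \<theta>_def)
    then have b: "real_of_int b = (1 - \<theta>) * real_of_int a + \<theta> * real_of_int c"
      by (simp add: algebra_simps)
    have "embed (pt b j) = (1 - \<theta>) *\<^sub>R embed (pt a j) + \<theta> *\<^sub>R embed (pt c j)"
      by (simp add: embed_def pt_def b) (simp add: algebra_simps)
    then show ?thesis using embed_convex_combination[OF F _ _ th] ac by blast
  qed
qed

text \<open>The segment splits into \<open>q\<close> blocks of \<open>d\<close> consecutive points,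
  each a monomial times the strongly linear polynomial.\<close>

lemma strongly_linear_dvd_segment:
  assumes "d > 0"
  shows "strongly_linear u (d - 1) dvd (\<Sum>i\<in>{l..<l + int (d * q)}. Poly_Mapping.single (pt i j) 1)"
proof (induction q)
  case 0
  then show ?case by simp
next
  case (Suc q)
  let ?a = "l + int (d * q)"
  have "(\<Sum>i\<in>{?a..<?a + int d}. Poly_Mapping.single (pt i j) (1::int))
      = (\<Sum>i=0..d - 1. Poly_Mapping.single (pt (?a + int i) j) 1)"
    using assms by (intro sum.reindex_bij_witness[of _ "\<lambda>i. ?a + int i" "\<lambda>i. nat (i - ?a)"]) auto
  also have "\<dots> = Poly_Mapping.single (pt ?a j) 1 * strongly_linear u (d - 1)"
    unfolding strongly_linear_def sum_distrib_left
    by (simp add: mult_single pt_def algebra_simps plus_prod_def)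
  finally have "strongly_linear u (d - 1) dvd (\<Sum>i\<in>{?a..<?a + int d}. Poly_Mapping.single (pt i j) 1)"
    by simp
  moreover have "{l..<l + int (d * Suc q)} = {l..<?a} \<union> {?a..<?a + int d}"
    using ivl_disj_un_two(3)[of l ?a "?a + int d"] by (simp add: algebra_simps)
  then have "(\<Sum>i\<in>{l..<l + int (d * Suc q)}. Poly_Mapping.single (pt i j) (1::int)) =
     (\<Sum>i\<in>{l..<?a}. Poly_Mapping.single (pt i j) 1) + (\<Sum>i\<in>{?a..<?a + int d}. Poly_Mapping.single (pt i j) 1)"
    by (simp only:) (rule sum.union_disjoint; auto)
  ultimately show ?case using Suc.IH by (simp only: dvd_add)
qed

text \<open>By convexity each line sum is a geometric sum over an interval. If all vanish, the order
  of \<zeta> divides the number of points of every line, and a strongly linear polynomial divides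
  the figure polynomial line by line.\<close>

lemma line_sum_nonzero:
  assumes F: "convex_figure F" "F \<noteq> {}" and z: "\<zeta> ^ m = 1" "m > 0"
    and no_dvd: "\<And>n. n \<ge> 1 \<Longrightarrow> \<not> strongly_linear u n dvd figure_poly F"
  shows "\<exists>j. line_sum F \<zeta> j \<noteq> 0"
proof (rule ccontr)
  assume "\<not> ?thesis"
  then have zero: "line_sum F \<zeta> j = 0" for j by blast
  have finF: "finite F" using F(1) unfolding convex_figure_def by blast
  have z0: "\<zeta> \<noteq> 0" using z by (metis power_0_left zero_neq_one not_gr0)
  show False
  proof (cases "\<zeta> = 1")
    \<comment> \<open>At \<zeta> = 1 a line sum counts points, so it is non-zero on a line that
      meets \<open>F\<close>.\<close>
    case True
    obtain i j where "pt i j \<in> F" using F(2) pt_cases by (metis ex_in_conv)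
    then have "card {i. pt i j \<in> F} \<noteq> 0" using finite_lines(1)[OF finF, of j] by auto
    then show False using zero[of j] True by (simp add: line_sum_def)
  next
    case False
    define d where "d = (LEAST d. d > 0 \<and> \<zeta> ^ d = 1)"
    have d: "d > 0" "\<zeta> ^ d = 1"
      using LeastI[of "\<lambda>d. d > 0 \<and> \<zeta> ^ d = 1" m] z by (auto simp: d_def)
    have least: "k = 0" if "k < d" "\<zeta> ^ k = 1" for k
      using not_less_Least[of k "\<lambda>d. d > 0 \<and> \<zeta> ^ d = 1"] that by (auto simp: d_def)
    \<comment> \<open>\<zeta> \<noteq> 1 makes the order at least 2, so the divisor found is
      non-trivial.\<close>
    have d1: "d - 1 \<ge> 1" using False d by (cases "d = 1") auto
    have "strongly_linear u (d - 1) dvd (\<Sum>i | pt i j \<in> F. Poly_Mapping.single (pt i j) 1)" for j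
    proof -
      obtain l k where lk: "{i. pt i j \<in> F} = {l..<l + int k}" using line_interval[OF F(1)] by blast
      have "line_sum F \<zeta> j = (\<Sum>i<k. \<zeta> powi (l + int i))"
        unfolding line_sum_def lk
        by (rule sum.reindex_bij_witness[of _ "\<lambda>i. l + int i" "\<lambda>i. nat (i - l)"]) auto
      also have "\<dots> = \<zeta> powi l * (\<Sum>i<k. \<zeta> ^ i)"
        using z0 by (simp add: power_int_add sum_distrib_left)
      finally have "\<zeta> ^ k = 1"
        using zero z0 False by (simp add: geometric_sum)
      moreover have "\<zeta> ^ k = \<zeta> ^ (k mod d)"
        using d(2) by (metis mod_mult_div_eq mult.right_neutral power_add power_mult power_one)
      ultimately have "k mod d = 0" using least d(1) by simp
      then obtain q where "k = d * q" by auto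
      then show ?thesis unfolding lk using strongly_linear_dvd_segment[OF d(1)] by simp
    qed
    then have "strongly_linear u (d - 1) dvd figure_poly F"
      unfolding figure_poly_def sum_by_lines[OF finF] by (rule dvd_sum)
    then show False using no_dvd d1 by blast
  qed
qed

end

text \<open>A discrete Fourier transform along \<open>u\<close> writes \<open>f\<close> as an
  average of eigenfunctions of translation by \<open>u\<close>, each of which is doubly
  periodic.\<close>

lemma balanced_periodic_doubly_periodic:
  assumes F: "convex_figure F" "F \<noteq> {}"
    and no_dvd: "\<And>v n. v \<noteq> 0 \<Longrightarrow> n \<ge> 1 \<Longrightarrow> \<not> strongly_linear v n dvd figure_poly F"
    and bal: "balanced F f" and v: "v \<noteq> 0" "\<And>x. f (x + v) = f x"
  shows "doubly_periodic f"
proof -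
  define g where "g = gcd (fst v) (snd v)"
  define u where "u = (fst v div g, snd v div g)"
  define m where "m = nat g"
  have g: "g > 0" using v(1) by (auto simp: g_def prod_eq_iff)
  have vu: "v = scaled (int m) u"
    using g by (auto simp: u_def m_def scaled_def g_def prod_eq_iff)
  have m: "m > 0" using g by (simp add: m_def)
  obtain s t where "s * fst v + t * snd v = g" using bezout_int unfolding g_def by blast
  then have "g * (s * fst u + t * snd u) = g * 1"
    unfolding vu using g by (simp add: m_def scaled_def algebra_simps)
  then interpret primitive_frame u s t using g by unfold_locales simp
  have u0: "u \<noteq> 0" using vu v(1) by auto
  define \<omega> where "\<omega> = exp (2 * complex_of_real pi * \<i> / of_nat m)"
  have om: "\<omega> ^ i = 1 \<longleftrightarrow> m dvd i" for i
    using complex_root_unity_eq_1[of m i] m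
    by (simp add: \<omega>_def algebra_simps flip: exp_of_nat_mult)
  \<comment> \<open>Up to the factor \<open>m\<close>, the projection of \<open>f\<close> to the
    eigenspace with eigenvalue \<open>inverse (\<omega> ^ k)\<close>.\<close>
  define G where "G k x = (\<Sum>i<m. (\<omega> ^ k) ^ i * f (x + scaled (int i) u))" for k x
  have bG: "balanced F (G k)" for k
    unfolding G_def by (intro balanced_sum balanced_cmult balanced_shift bal)
  have dG: "doubly_periodic (G k)" for k
  proof -
    define \<zeta> where "\<zeta> = inverse (\<omega> ^ k)"
    have o0: "\<omega> \<noteq> 0" by (simp add: \<omega>_def)
    have ok: "(\<omega> ^ k) ^ m = 1" using om[of "k * m"] by (simp add: power_mult)
    then have zm: "\<zeta> ^ m = 1" by (simp add: \<zeta>_def power_inverse)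
    have mult: "\<omega> ^ k * G k (x + u) = G k x" for x
    proof -
      have "\<omega> ^ k * G k (x + u) = (\<Sum>i<m. (\<omega> ^ k) ^ Suc i * f (x + scaled (int (Suc i)) u))"
        unfolding G_def sum_distrib_left
        by (intro sum.cong refl) (simp add: scaled_add_left add.assoc)
      also have "\<dots> = G k x"
        unfolding G_def using v(2) ok
        by (intro sum_lessThan_Suc_cyclic[where g = "\<lambda>i. (\<omega> ^ k) ^ i * f (x + scaled (int i) u)"])
           (simp add: vu)
      finally show ?thesis .
    qed
    have eig: "G k (x + u) = \<zeta> * G k x" for x
      using o0 unfolding mult[of x, symmetric] \<zeta>_def by simp
    obtain j where "line_sum F \<zeta> j \<noteq> 0"
      using line_sum_nonzero[OF F zm m] no_dvd u0 by blast
    moreover have "finite F" using F(1) unfolding convex_figure_def by blast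
    ultimately show ?thesis using eigenfunction_doubly_periodic[OF _ bG eig zm m] by blast
  qed
  \<comment> \<open>Fourier inversion: by orthogonality of the roots of unity only the term
    \<open>i = 0\<close> survives.\<close>
  have "f x = (\<Sum>k<m. G k x) / of_nat m" for x
  proof -
    have "(\<Sum>k<m. G k x) = (\<Sum>i<m. \<Sum>k<m. (\<omega> ^ i) ^ k * f (x + scaled (int i) u))"
      unfolding G_def by (subst sum.swap) (simp add: mult.commute flip: power_mult)
    also have "\<dots> = (\<Sum>i<m. if i = 0 then of_nat m * f x else 0)"
    proof (intro sum.cong refl)
      fix i assume i: "i \<in> {..<m}"
      show "(\<Sum>k<m. (\<omega> ^ i) ^ k * f (x + scaled (int i) u)) = (if i = 0 then of_nat m * f x else 0)"
      proof (cases "i = 0")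
        case False
        then have "\<omega> ^ i \<noteq> 1" using om i by (auto dest: dvd_imp_le)
        moreover have "(\<omega> ^ i) ^ m = 1" using om[of "i * m"] by (simp add: power_mult)
        ultimately show ?thesis using False by (simp add: geometric_sum flip: sum_distrib_right)
      qed simp
    qed
    also have "\<dots> = of_nat m * f x" using m by simp
    finally show ?thesis using m by simp
  qed
  then have "f = (\<lambda>x. (\<Sum>k<m. G k x) / of_nat m)" by blast
  moreover have "doubly_periodic (\<lambda>x. (\<Sum>k<m. G k x) / of_nat m)"
    using doubly_periodic_map[OF doubly_periodic_sum[of "{..<m}" G], where h = "\<lambda>z. z / of_nat m"] dG by blast
  ultimately show ?thesis by simp
qed

section \<open>Doubly periodic differences\<close>

lemma period_multiple:
  assumes "\<And>x. f (x + p) = f x"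
  shows "f (x + scaled k p) = f x"
proof (induction k rule: int_induct[where k = 0])
  case base
  then show ?case by simp
next
  case (step1 k)
  then show ?case using assms[of "x + scaled k p"] by (simp add: scaled_add_left add.assoc)
next
  case (step2 k)
  have "x + scaled k p = x + scaled (k - 1) p + p"
    using scaled_add_left[of "k - 1" 1 p] by (simp add: add.assoc)
  then show ?case using assms[of "x + scaled (k - 1) p"] step2 by (simp only:)
qed

lemma doubly_periodicI:
  assumes "A > 0" "B > 0" "\<And>x. f (x + scaled A (1, 0)) = f x" "\<And>x. f (x + scaled B (0, 1)) = f x"
  shows "doubly_periodic f"
  unfolding doubly_periodic_def
proof (intro exI[of _ "A * B"] conjI allI)
  fix x a
  have "x + scaled (A * B) a
      = x + scaled (B * fst a) (scaled A (1, 0)) + scaled (A * snd a) (scaled B (0, 1))"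
    by (simp add: scaled_def prod_eq_iff)
  then show "f (x + scaled (A * B) a) = f x"
    using period_multiple[of f, OF assms(3)] period_multiple[of f, OF assms(4)] by (simp only:)
qed (use assms in simp)

text \<open>With vanishing second differences, \<open>f\<close> runs along \<open>p\<close> through
  an arithmetic progression, and a finite range forces its common difference to be 0.\<close>

lemma finite_range_periodic_difference:
  fixes f :: "point \<Rightarrow> complex"
  assumes fin: "finite (range f)" and per: "\<And>x. f (x + p + p) - f (x + p) = f (x + p) - f x"
  shows "f (x + p) = f x"
proof (rule ccontr)
  assume neq: "f (x + p) \<noteq> f x"
  have Sucp: "x + scaled (int (Suc n)) p = x + scaled (int n) p + p" for n
    by (simp add: scaled_add_left add.assoc add.commute)
  have step: "f (x + scaled (int n) p + p) - f (x + scaled (int n) p) = f (x + p) - f x" for n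
  proof (induction n)
    case (Suc n)
    then show ?case unfolding Sucp using per[of "x + scaled (int n) p"] by simp
  qed simp
  have lin: "f (x + scaled (int n) p) = f x + of_nat n * (f (x + p) - f x)" for n
  proof (induction n)
    case (Suc n)
    have "f (x + scaled (int (Suc n)) p) = f (x + scaled (int n) p + p)"
      unfolding Sucp ..
    also have "\<dots> = f (x + scaled (int n) p) + (f (x + p) - f x)"
      using step[of n] by (simp add: algebra_simps)
    finally show ?case using Suc by (simp add: algebra_simps)
  qed simp
  have "inj (\<lambda>n. f (x + scaled (int n) p))"
    unfolding lin using neq by (auto intro!: injI)
  moreover have "finite (range (\<lambda>n. f (x + scaled (int n) p)))"
    by (rule finite_subset[OF _ fin]) auto
  ultimately show False using finite_imageD infinite_UNIV_nat by blast
qed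

lemma doubly_periodic_antidifference:
  assumes F: "convex_figure F" "F \<noteq> {}"
    and no_dvd: "\<And>v n. v \<noteq> 0 \<Longrightarrow> n \<ge> 1 \<Longrightarrow> \<not> strongly_linear v n dvd figure_poly F"
    and bal: "balanced F f" and ab: "a \<noteq> b" and diff: "doubly_periodic (\<lambda>x. f (x + a) - f (x + b))"
  shows "doubly_periodic f"
proof -
  obtain M where M: "M > 0" "\<And>x e. f (x + scaled M e + a) - f (x + scaled M e + b) = f (x + a) - f (x + b)"
    using diff unfolding doubly_periodic_def by blast
  have "\<exists>N>0. \<forall>x. f (x + scaled (M * int N) e) = f x" for e
  proof -
    define \<psi> where "\<psi> x = f (x + scaled M e) - f x" for x
    have "balanced F \<psi>"
      unfolding \<psi>_def by (intro balanced_diff balanced_shift bal)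
    moreover have "\<psi> (x + (a - b)) = \<psi> x" for x
      using M(2)[of "x - b" e] by (simp add: \<psi>_def algebra_simps)
    ultimately have "doubly_periodic \<psi>"
      using balanced_periodic_doubly_periodic[OF F no_dvd, of \<psi> "a - b"] ab by auto
    then obtain N where N: "N > 0" "\<And>x y. \<psi> (x + scaled N y) = \<psi> x" unfolding doubly_periodic_def
        by blast
    \<comment> \<open>The increment of \<open>f\<close> over \<open>n\<close> steps of
      \<open>scaled M e\<close> is a sum of \<open>n\<close> values of \<psi>, so it inherits the
      periods of \<psi>.\<close>
    have D: "f (x + scaled N y + scaled (M * int n) e) - f (x + scaled N y) = f (x + scaled (M * int n) e) - f x"
      for n x y
    proof (induction n)
      case (Suc n)
      have step: "f (x + scaled (M * int (Suc n)) e) = f (x + scaled (M * int n) e) + \<psi> (x + scaled (M * int n) e)" for x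
        by (simp add: \<psi>_def scaled_add_left distrib_left add.assoc add.commute add.left_commute)
      have "\<psi> (x + scaled N y + scaled (M * int n) e) = \<psi> (x + scaled (M * int n) e)"
        using N(2)[of "x + scaled (M * int n) e" y] by (simp add: algebra_simps)
      then show ?case unfolding step using Suc by (simp add: algebra_simps)
    qed simp
    let ?p = "scaled (M * int (nat N)) e"
    have "f (x + ?p) = f x" for x
    proof (rule finite_range_periodic_difference)
      show "finite (range f)" using bal unfolding balanced_def by blast
      \<comment> \<open>For \<open>y = scaled M e\<close> and \<open>n = nat N\<close> the period of
        the increment and the step itself both equal \<open>?p\<close>, so the second difference
        vanishes.\<close>
      show "f (x + ?p + ?p) - f (x + ?p) = f (x + ?p) - f x" for x
        using D[of x "scaled M e" "nat N"] N(1) by (simp add: scaled_scaled mult.commute)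
    qed
    then show ?thesis using N(1) by (intro exI[of _ "nat N"]) auto
  qed
  then obtain A B where "A > 0" "B > 0"
    "\<And>x. f (x + scaled (M * int A) (1, 0)) = f x" "\<And>x. f (x + scaled (M * int B) (0, 1)) = f x"
    by metis
  then show ?thesis using M(1) by (intro doubly_periodicI[of "M * int A" "M * int B"]) auto
qed

text \<open>Vandermonde elimination, one point of \<open>E\<close> at a time: subtracting from the equation for
  \<open>i + 1\<close> the \<open>e\<close>-translate of the equation
      for \<open>i\<close> removes the term of \<open>e\<close>.\<close>

lemma vandermonde_doubly_periodic:
  assumes F: "convex_figure F" "F \<noteq> {}"
    and no_dvd: "\<And>v n. v \<noteq> 0 \<Longrightarrow> n \<ge> 1 \<Longrightarrow> \<not> strongly_linear v n dvd figure_poly F"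
    and r: "r \<noteq> 0" and E: "finite E" and bal: "\<And>e. e \<in> E \<Longrightarrow> balanced F (h e)"
    and const: "\<And>i. \<exists>c. \<forall>x. (\<Sum>e\<in>E. h e (x + scaled (int i * r) e)) = c"
  shows "\<forall>e\<in>E. doubly_periodic (h e)"
  using E bal const
proof (induction E arbitrary: h rule: finite_induct)
  case empty
  then show ?case by simp
next
  case (insert e E)
  define h' where "h' e' x = h e' (x + scaled r e') - h e' (x + scaled r e)" for e' x
  have dE': "\<forall>e'\<in>E. doubly_periodic (h' e')"
  proof (rule insert.IH)
    show "balanced F (h' e')" if "e' \<in> E" for e'
      unfolding h'_def using insert.prems(1) that by (intro balanced_diff balanced_shift) auto
    show "\<exists>c. \<forall>x. (\<Sum>e'\<in>E. h' e' (x + scaled (int i * r) e')) = c" for i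
    proof -
      let ?S = "\<lambda>i x. \<Sum>e'\<in>insert e E. h e' (x + scaled (int i * r) e')"
      obtain c where c: "\<And>x. ?S i x = c" using insert.prems(2) by blast
      obtain c' where c': "\<And>x. ?S (Suc i) x = c'" using insert.prems(2) by blast
      have 1: "x + scaled (int (Suc i) * r) e' = x + scaled (int i * r) e' + scaled r e'" for e' x
        by (simp add: scaled_add_left distrib_right add.assoc add.commute)
      have 2: "x + scaled r e + scaled (int i * r) e' = x + scaled (int i * r) e' + scaled r e" for e' x
        by (simp add: add.assoc add.commute)
      have "(\<Sum>e'\<in>E. h' e' (x + scaled (int i * r) e')) = ?S (Suc i) x - ?S i (x + scaled r e)" for x
        unfolding 1 2 h'_def using insert.hyps by (simp add: sum_subtractf)
      then show ?thesis unfolding c c' by blast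
    qed
  qed
  \<comment> \<open>As \<open>r \<noteq> 0\<close> and \<open>e' \<noteq> e\<close>, the function
    \<open>h' e'\<close> is a difference of two distinct translates of \<open>h e'\<close>.\<close>
  have dE: "doubly_periodic (h e')" if "e' \<in> E" for e'
  proof (rule doubly_periodic_antidifference[OF F no_dvd])
    show "balanced F (h e')" using insert.prems(1) that by blast
    show "scaled r e' \<noteq> scaled r e" using r insert.hyps(2) that by auto
    show "doubly_periodic (\<lambda>x. h e' (x + scaled r e') - h e' (x + scaled r e))"
      using dE' that unfolding h'_def by blast
  qed auto
  \<comment> \<open>The equation for \<open>i = 0\<close> involves no dilation and expresses the
    eliminated \<open>h e\<close> through the other functions.\<close>
  obtain c where "\<And>x. (\<Sum>e'\<in>insert e E. h e' (x + scaled (int 0 * r) e')) = c"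
    using insert.prems(2) by blast
  then have "h e = (\<lambda>x. c - (\<Sum>e'\<in>E. h e' x))"
    using insert.hyps by (auto simp: fun_eq_iff algebra_simps)
  moreover have "doubly_periodic (\<lambda>x. c - (\<Sum>e'\<in>E. h e' x))"
    using doubly_periodic_map[OF doubly_periodic_sum[of E h], where h = "\<lambda>z. c - z"] dE by blast
  ultimately show ?case using dE by simp
qed

section \<open>Independence of integer vectors\<close>

lemma det_nonzero_if_independent:
  assumes "p \<noteq> q" "independent {embed p, embed q}"
  shows "fst p * snd q \<noteq> snd p * fst q"
proof
  assume det: "fst p * snd q = snd p * fst q"
  have "embed p \<noteq> embed q" using assms(1) by (simp add: embed_def prod_eq_iff)
  then have nspan: "embed p \<notin> span {embed q}"
    using assms(2) by (simp add: independent_insert)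
  have "embed q \<noteq> 0" using assms(2) dependent_zero[of "{embed p, embed q}"] by (metis insertCI)
  then have "fst q \<noteq> 0 \<or> snd q \<noteq> 0" by (auto simp: embed_def zero_prod_def)
  then have "\<exists>c. embed p = c *\<^sub>R embed q"
  proof
    assume q: "fst q \<noteq> 0"
    have "real_of_int (fst p) * real_of_int (snd q) = real_of_int (snd p) * real_of_int (fst q)"
      using det by (metis of_int_mult)
    with q show ?thesis
      by (intro exI[of _ "real_of_int (fst p) / real_of_int (fst q)"]) (simp add: embed_def field_simps)
  next
    assume q: "snd q \<noteq> 0"
    have "real_of_int (fst p) * real_of_int (snd q) = real_of_int (snd p) * real_of_int (fst q)"
      using det by (metis of_int_mult)
    with q show ?thesis
      by (intro exI[of _ "real_of_int (snd p) / real_of_int (snd q)"]) (simp add: embed_def field_simps)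
  qed
  then show False using nspan by (auto simp: span_singleton)
qed

lemma independent_axes:
  assumes "M > 0"
  shows "independent {embed (M, 0), embed (0, M)}"
  using assms by (auto simp: independent_insert span_singleton embed_def zero_prod_def)

section \<open>Words with constant letter counts\<close>

lemma doubly_periodic_imp_fully_periodic:
  assumes "doubly_periodic w"
  shows "fully_periodic w"
proof -
  obtain M where M: "M > 0" "\<And>x a. w (x + scaled M a) = w x" using assms unfolding doubly_periodic_def by blast
  have "w (x + (M, 0)) = w x" "w (x + (0, M)) = w x" for x
    using M(2)[of x "(1, 0)"] M(2)[of x "(0, 1)"] by (simp_all add: scaled_def)
  then show ?thesis unfolding fully_periodic_def
    using M(1) independent_axes by (intro exI[of _ "(M, 0)"] exI[of _ "(0, M)"]) auto
qed

lemma pattern_translates: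
  assumes "is_pattern P" "F \<in> P"
  shows "P = range (\<lambda>t. (+) t ` F)"
proof -
  obtain F0 where F0: "P = range (\<lambda>t. (+) t ` F0)" using assms(1) unfolding is_pattern_def by blast
  then obtain a where a: "F = (+) a ` F0" using assms(2) by blast
  have "(+) t ` F = (+) (t + a) ` F0" for t
    unfolding a by (simp add: image_image add.assoc)
  then have "range (\<lambda>t. (+) t ` F) = (\<lambda>t. (+) t ` F0) ` range (\<lambda>t. t + a)"
    by (simp only: image_image)
  moreover have "surj (\<lambda>t. t + a)" by (rule surjI[of _ "\<lambda>t. t - a"]) simp
  ultimately show ?thesis using F0 by simp
qed

text \<open>Letters are read as numbers, so constant letter counts become constant sums.\<close>

lemma sum_eq_letter_counts:
  fixes w :: "point \<Rightarrow> nat"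
  assumes "finite A" "w \<in> UNIV \<rightarrow> A" "finite G"
  shows "(\<Sum>x\<in>G. w x) = (\<Sum>a\<in>A. a * letter_counts w G a)"
proof -
  have "(\<Sum>x\<in>G. w x) = (\<Sum>a\<in>A. \<Sum>x\<in>{x\<in>G. w x = a}. w x)"
    using assms by (intro sum.group[symmetric]) auto
  also have "\<dots> = (\<Sum>a\<in>A. a * letter_counts w G a)"
    by (intro sum.cong refl) (simp add: letter_counts_def)
  finally show ?thesis .
qed

lemma fully_periodic_if_no_strongly_linear_divisor:
  fixes w :: "point \<Rightarrow> nat"
  assumes F: "convex_figure F" "F \<noteq> {}"
    and no_dvd: "\<And>v n. v \<noteq> 0 \<Longrightarrow> n \<ge> 1 \<Longrightarrow> \<not> strongly_linear v n dvd figure_poly F"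
    and A: "finite A" "w \<in> UNIV \<rightarrow> A" and const: "\<And>x. (\<Sum>p\<in>F. w (x + p)) = c"
  shows "fully_periodic w"
proof -
  have finF: "finite F" using F(1) unfolding convex_figure_def by blast
  have wA: "w x \<in> A" for x using A(2) by auto
  have "\<exists>r>0. \<forall>i x y. (\<Sum>p\<in>F. int (w (x + scaled (1 + int i * r) p)))
      = (\<Sum>p\<in>F. int (w (y + scaled (1 + int i * r) p)))"
  proof (rule sum_scaled_const[OF finF])
    show "(\<Sum>p\<in>F. int (w (x + p))) = int c" for x
      using const[of x] by (metis of_nat_sum)
    show "int (w x) \<le> int (Max A)" for x using A(1) wA by simp
  qed simp
  then obtain r where r: "r > 0"
    and int_eq: "\<And>i x y. (\<Sum>p\<in>F. int (w (x + scaled (1 + int i * r) p)))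
        = (\<Sum>p\<in>F. int (w (y + scaled (1 + int i * r) p)))"
    by blast
  have eq: "(\<Sum>p\<in>F. w (x + scaled (1 + int i * r) p))
      = (\<Sum>p\<in>F. w (y + scaled (1 + int i * r) p))" for i x y
    using int_eq[of x i y] by (simp only: of_nat_eq_iff flip: of_nat_sum)
  \<comment> \<open>Since \<open>x + scaled (1 + int i * r) e\<close> is
    \<open>(x + scaled (int i * r) e) + e\<close>, the dilated sums of \<open>w\<close> become a
    Vandermonde system for its translates.\<close>
  define h where "h e x = complex_of_nat (w (x + e))" for e x
  have "balanced F (\<lambda>x. complex_of_nat (w x))"
  proof -
    have "range (\<lambda>x. complex_of_nat (w x)) \<subseteq> of_nat ` A" using wA by auto
    then have "finite (range (\<lambda>x. complex_of_nat (w x)))" using A(1) finite_surj by blast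
    moreover have "(\<Sum>p\<in>F. complex_of_nat (w (x + p))) = of_nat c" for x
      using const[of x] by (metis of_nat_sum)
    ultimately show ?thesis unfolding balanced_def by blast
  qed
  then have bal: "balanced F (h e)" for e
    unfolding h_def by (rule balanced_shift)
  have "\<forall>e\<in>F. doubly_periodic (h e)"
  proof (rule vandermonde_doubly_periodic[OF F no_dvd _ finF bal])
    show "r \<noteq> 0" using r by simp
    show "\<exists>c. \<forall>x. (\<Sum>e\<in>F. h e (x + scaled (int i * r) e)) = c" for i
    proof -
      have sum_h: "(\<Sum>e\<in>F. h e (x + scaled (int i * r) e)) = of_nat (\<Sum>p\<in>F. w (x + scaled (1 + int i * r) p))" for x
        by (simp add: h_def scaled_add_left ac_simps)
      have "(\<Sum>e\<in>F. h e (x + scaled (int i * r) e)) = of_nat (\<Sum>p\<in>F. w (0 + scaled (1 + int i * r) p))" for x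
        by (simp only: sum_h eq[of x i 0])
      then show ?thesis by blast
    qed
  qed
  then obtain e where "doubly_periodic (h e)" using F(2) by blast
  then have "doubly_periodic (\<lambda>x. h e (x + - e))" by (rule doubly_periodic_shift)
  then have "doubly_periodic w" by (simp add: h_def doubly_periodic_def)
  then show ?thesis by (rule doubly_periodic_imp_fully_periodic)
qed

section \<open>A non-periodic word from a strongly linear divisor\<close>

lemma sum_dvd_window: "(\<Sum>i=0..n. if int (Suc n) dvd a + int i then 1 else 0 :: int) = 1"
proof -
  let ?r = "nat (- a mod int (Suc n))"
  have "- a mod int (Suc n) < int (Suc n)" by (rule pos_mod_bound) simp
  then have r: "?r \<le> n" by linarith
  have "int (Suc n) dvd a + int i \<longleftrightarrow> i = ?r" if "i \<le> n" for i
  proof -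
    have "int (Suc n) dvd a + int i \<longleftrightarrow> - a mod int (Suc n) = int i mod int (Suc n)"
      by (simp add: mod_eq_dvd_iff dvd_diff_commute[of _ "- a"] add.commute)
    also have "int i mod int (Suc n) = int i" using that by simp
    finally show ?thesis by auto
  qed
  then have "(\<Sum>i=0..n. if int (Suc n) dvd a + int i then 1 else 0 :: int)
      = (\<Sum>i=0..n. if i = ?r then 1 else 0)"
    by (intro sum.cong) auto
  then show ?thesis using r by simp
qed

text \<open>For letters 0 and 1 the sum counts the ones, and the cardinality then determines the
  zeros.\<close>

lemma letter_counts_binary:
  fixes w :: "point \<Rightarrow> nat"
  assumes "finite G" "finite H" "\<And>x. w x \<le> 1"
    and "card G = card H" "(\<Sum>x\<in>G. w x) = (\<Sum>x\<in>H. w x)"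
  shows "letter_counts w G = letter_counts w H"
proof
  fix a
  have w: "w x = 0 \<or> w x = 1" for x using assms(3)[of x] by linarith
  then have w': "w \<in> UNIV \<rightarrow> {0, 1}" by blast
  have sum: "(\<Sum>x\<in>G. w x) = letter_counts w G 1" if "finite G" for G
    using sum_eq_letter_counts[OF _ w' that] by simp
  have card: "letter_counts w G 0 + letter_counts w G 1 = card G" if "finite G" for G
  proof -
    have "G = {x\<in>G. w x = 0} \<union> {x\<in>G. w x = 1}" using w by blast
    then have "card G = card ({x\<in>G. w x = 0} \<union> {x\<in>G. w x = 1})" by simp
    also have "\<dots> = card {x\<in>G. w x = 0} + card {x\<in>G. w x = 1}"
      using that by (intro card_Un_disjoint) auto
    finally show ?thesis by (simp add: letter_counts_def)
  qed
  have big: "letter_counts w G a = 0" if "a > 1" for G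
  proof -
    have "w x \<noteq> a" for x using assms(3)[of x] that by linarith
    then show ?thesis by (simp add: letter_counts_def)
  qed
  consider "a = 0" | "a = 1" | "a > 1" by linarith
  moreover have one: "letter_counts w G 1 = letter_counts w H 1"
    using sum[OF assms(1)] sum[OF assms(2)] assms(5) by linarith
  moreover have "letter_counts w G 0 = letter_counts w H 0"
    using card[OF assms(1)] card[OF assms(2)] assms(4) one by linarith
  ultimately show "letter_counts w G a = letter_counts w H a"
    using big by cases simp_all
qed

text \<open>Along each line in direction \<open>v\<close> the word has period \<open>n + 1\<close> with one letter 1 per period;
  shifting the phase on the single line through the origin destroys the periods not parallel
  to \<open>v\<close>.\<close>

lemma not_fully_periodic_word:
  assumes v: "v \<noteq> (0 :: point)" and n: "n \<ge> 1"
  shows "\<exists>w :: point \<Rightarrow> nat. (\<forall>x. w x \<le> 1) \<and> (\<forall>x. (\<Sum>i=0..n. int (w (x + scaled (int i) v))) = 1)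
    \<and> \<not> fully_periodic w"
proof -
  \<comment> \<open>A coordinate along the lines in direction \<open>v\<close> that grows by exactly
    1 with each step \<open>v\<close>; \<open>det\<close> is constant on these lines and vanishes on
    the line through the origin.\<close>
  define pos where "pos x = (if fst v \<noteq> 0 then fst x div fst v else snd x div snd v)" for x :: point
  define det where "det x = fst v * snd x - snd v * fst x" for x :: point
  define w where "w x = (if int (Suc n) dvd pos x - (if det x = 0 then 1 else 0) then 1 else 0 :: nat)" for x
  have "fst v \<noteq> 0 \<or> snd v \<noteq> 0" using v by (simp add: prod_eq_iff)
  then have pos: "pos (x + scaled k v) = pos x + k" for x k
    by (auto simp: pos_def scaled_def)
  have det: "det (x + scaled k v) = det x" for x k
    by (simp add: det_def scaled_def algebra_simps)
  have "(\<Sum>i=0..n. int (w (x + scaled (int i) v))) = 1" for x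
  proof -
    have "(\<Sum>i=0..n. int (w (x + scaled (int i) v)))
      = (\<Sum>i=0..n. if int (Suc n) dvd (pos x - (if det x = 0 then 1 else 0)) + int i then 1 else 0)"
      by (intro sum.cong refl) (simp add: w_def pos det algebra_simps)
    then show ?thesis by (simp only: sum_dvd_window)
  qed
  moreover have "\<not> fully_periodic w"
  proof
    assume "fully_periodic w"
    then obtain p q where pq: "p \<noteq> q" "independent {embed p, embed q}"
        "\<And>x. w (x + p) = w x" "\<And>x. w (x + q) = w x"
      unfolding fully_periodic_def by blast
    have no_period: False if per: "\<And>x. w (x + p) = w x" and d: "det p \<noteq> 0" for p
    proof -
      \<comment> \<open>The factor \<open>m\<close> makes the division in \<open>pos\<close> exact
        and \<open>Suc n\<close> makes the result divisible by \<open>Suc n\<close>. This multiple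
        of \<open>p\<close> lies off the line through the origin, so it carries the letter 1,
        whereas the shifted phase puts 0 at the origin.\<close>
      define m where "m = (if fst v \<noteq> 0 then fst v else snd v)"
      have m: "m \<noteq> 0" using \<open>fst v \<noteq> 0 \<or> snd v \<noteq> 0\<close> by (auto simp: m_def)
      have "det (scaled (int (Suc n) * m) p) = int (Suc n) * m * det p"
        by (simp add: det_def scaled_def algebra_simps)
      then have "det (scaled (int (Suc n) * m) p) \<noteq> 0" using d m by simp
      moreover have "pos (scaled (int (Suc n) * m) p) = int (Suc n) * (if fst v \<noteq> 0 then fst p else snd p)"
        using \<open>fst v \<noteq> 0 \<or> snd v \<noteq> 0\<close>
            by (auto simp: pos_def scaled_def m_def mult.assoc mult.left_commute[of "fst v"]
                mult.left_commute[of "snd v"])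
      ultimately have "w (scaled (int (Suc n) * m) p) = 1"
        by (simp add: w_def)
      moreover have "w 0 = 0"
        using n zdvd_imp_le[of "int (Suc n)" 1] by (auto simp: w_def pos_def det_def)
      ultimately show False
        using period_multiple[of w p 0 "int (Suc n) * m"] per by simp
    qed
    have "det p = 0" "det q = 0" using no_period pq(3,4) by blast+
    then have eq: "fst v * snd p = snd v * fst p" "fst v * snd q = snd v * fst q"
      by (simp_all add: det_def)
    have "fst v * (fst p * snd q - snd p * fst q) = 0" "snd v * (fst p * snd q - snd p * fst q) = 0"
      using eq by algebra+
    then show False
      using \<open>fst v \<noteq> 0 \<or> snd v \<noteq> 0\<close> det_nonzero_if_independent[OF pq(1,2)] by auto
  qed
  moreover have "w x \<le> 1" for x by (simp add: w_def)
  ultimately show ?thesis by blast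
qed

text \<open>The strongly linear factor maps the word to the constant 1, and the cofactor maps
  constants to constants, so all translates of \<open>F\<close> contain equally many ones.\<close>

lemma not_abelian_rigid_if_strongly_linear_divisor:
  assumes P: "P = range (\<lambda>t. (+) t ` F)" and F: "finite F"
    and v: "v \<noteq> 0" and n: "n \<ge> 1" and dvd: "strongly_linear v n dvd figure_poly F"
  shows "\<not> abelian_rigid P"
proof -
  obtain w :: "point \<Rightarrow> nat" where w: "\<And>x. w x \<le> 1" "\<not> fully_periodic w"
    and one: "\<And>x. (\<Sum>i=0..n. int (w (x + scaled (int i) v))) = 1"
    using not_fully_periodic_word[OF v n] by metis
  obtain q where q: "figure_poly F = q * strongly_linear v n"
    using dvd by (metis dvdE mult.commute)
  have "(\<Sum>p\<in>F. int (w (x + p))) = act q (\<lambda>_. 1) 0" for x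
  proof -
    have "(\<Sum>p\<in>F. int (w (x + p))) = act (q * strongly_linear v n) (int \<circ> w) x"
      using act_figure_poly[of F "int \<circ> w" x] by (simp add: q)
    also have "\<dots> = act q (\<lambda>_. 1) x"
      using one by (simp add: act_mult act_strongly_linear[abs_def])
    finally show ?thesis using act_const[of q 1 x] by simp
  qed
  then have const: "(\<Sum>p\<in>F. int (w (x + p))) = (\<Sum>p\<in>F. int (w (y + p)))" for x y
    by simp
  have "letter_counts w ((+) t ` F) = letter_counts w F" for t
  proof (rule letter_counts_binary)
    have inj: "inj_on ((+) t) F" by simp
    show "card ((+) t ` F) = card F" by (rule card_image[OF inj])
    have "(\<Sum>x\<in>(+) t ` F. w x) = (\<Sum>p\<in>F. w (t + p))" by (simp add: sum.reindex[OF inj])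
    moreover have "int (\<Sum>p\<in>F. w (t + p)) = int (\<Sum>p\<in>F. w p)" using const[of t 0] by simp
    ultimately show "(\<Sum>x\<in>(+) t ` F. w x) = (\<Sum>x\<in>F. w x)" by linarith
  qed (use F w in auto)
  then have "abelian_complexity w P = 1"
    unfolding abelian_complexity_def P by (simp add: image_image)
  moreover have "w \<in> UNIV \<rightarrow> {..1}" using w(1) by auto
  ultimately show ?thesis using w(2) unfolding abelian_rigid_def by blast
qed

theorem theorem2:
  fixes P :: "(int \<times> int) set set" and F :: "(int \<times> int) set"
  assumes "convex_pattern P" and "F \<in> P"
  shows "(\<exists>v n. v \<noteq> 0 \<and> n \<ge> 1 \<and> strongly_linear v n dvd figure_poly F)
           \<longleftrightarrow> \<not> abelian_rigid P"
proof
  have F: "convex_figure F" and P: "P = range (\<lambda>t. (+) t ` F)"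
    using assms pattern_translates unfolding convex_pattern_def by blast+
  have finF: "finite F" using F unfolding convex_figure_def by blast
  show "\<not> abelian_rigid P" if "\<exists>v n. v \<noteq> 0 \<and> n \<ge> 1 \<and> strongly_linear v n dvd figure_poly F"
    using that not_abelian_rigid_if_strongly_linear_divisor[OF P finF] by blast
  show "\<exists>v n. v \<noteq> 0 \<and> n \<ge> 1 \<and> strongly_linear v n dvd figure_poly F" if "\<not> abelian_rigid P"
  proof (rule ccontr)
    assume no_dvd: "\<not> ?thesis"
    \<comment> \<open>The empty figure has polynomial 0, which every strongly linear polynomial
      divides.\<close>
    have "F \<noteq> {}"
    proof
      assume "F = {}"
      then have "strongly_linear (1, 0) 1 dvd figure_poly F" by (simp add: figure_poly_def)
      then show False using no_dvd by (metis one_neq_zero order_refl prod.inject zero_prod_def)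
    qed
    have "fully_periodic w" if A: "finite A" "w \<in> UNIV \<rightarrow> A" "abelian_complexity w P = 1"
      for A :: "nat set" and w
    proof -
      obtain l where "letter_counts w ` P = {l}"
        using A(3) by (auto simp: abelian_complexity_def card_1_singleton_iff)
      then have l: "letter_counts w ((+) t ` F) = l" for t unfolding P by blast
      have "(\<Sum>p\<in>F. w (x + p)) = (\<Sum>a\<in>A. a * l a)" for x
      proof -
        have "inj_on ((+) x) F" by simp
        then have "(\<Sum>p\<in>F. w (x + p)) = (\<Sum>p\<in>(+) x ` F. w p)" by (simp add: sum.reindex)
        also have "\<dots> = (\<Sum>a\<in>A. a * l a)"
          using sum_eq_letter_counts[OF A(1,2), of "(+) x ` F"] finF by (simp add: l)
        finally show ?thesis .
      qed
      then show ?thesis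
        using fully_periodic_if_no_strongly_linear_divisor[OF F \<open>F \<noteq> {}\<close> _ A(1,2)] no_dvd by blast
    qed
    then show False using \<open>\<not> abelian_rigid P\<close> unfolding abelian_rigid_def by blast
  qed
qed

end
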